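(* Let $N\ge2$ be an integer, let $\{\xi_n\}$ be a discrete-time $r_j$-random walk on $\Omega_N$ started at $0$, $Z_n=|\xi_n|$ and $Z_n^*=\max_{1\le m\le n}Z_m$, $n\ge1$. For all $j\ge1$ and $n\ge1$: (1) for the $r_j$-random walk, $$\mathbb P_0[Z_n^*=j]=\Big(\sum_{i=1}^jr_i\Big)^n-\Big(\sum_{i=1}^{j-1}r_i\Big)^n,\qquad\mathbb P_0[Z_n^*\ge j]=1-\Big(\sum_{i=1}^{j-1}r_i\Big)^n;$$ (2) for the $c^j$-random walk ($0<c<N$), $$\mathbb P_0[Z_n^*=j]=\Big(1-\Big(\frac cN\Big)^j\Big)^n-\Big(1-\Big(\frac cN\Big)^{j-1}\Big)^n,\qquad\mathbb P_0[Z_n^*\ge j]=1-\Big(1-\Big(\frac cN\Big)^{j-1}\Big)^n .$$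
   Context: $\Omega_N=\{x=(x_1,x_2,\dots): x_i\in\mathbb Z_N,\ x_i\ne0 \text{ for only finitely many } i\}$ with $\mathbb Z_N$ the cyclic group of order $N$ and componentwise addition mod $N$; $|x|=\max\{i:x_i\ne0\}$ for $x\neq 0$ and $|0|=0$. Given a probability distribution $(r_j)_{j\ge1}$ on $\{1,2,\dots\}$ with all $r_j>0$, the $r_j$-random walk is $\xi_n=\sum_{i=1}^n\eta_i$ with i.i.d. steps satisfying $\mathbb P[\eta=y]=\frac{r_{|y|}}{N^{|y|-1}(N-1)}$ for $y\neq0$ and $\mathbb P[\eta=0]=0$. The $c^j$-random walk is the $r_j$-random walk with $r_j=\left(1-\frac cN\right)\left(\frac cN\right)^{j-1}$, $j\ge1$. $\mathbb P_0$ is the law of the walk started at $0$. *)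

theory Defs
  imports "HOL-Probability.Probability" "HOL-Algebra.FiniteProduct"
    "HOL-Algebra.Product_Groups"
begin

(* The direct sum of copies of Z_N indexed by 1, 2, 3, ...; its elements are extensional functions,
   so the value at index 0 carries no information. The group is written multiplicatively:
   the zero sequence is \<one> and componentwise addition mod N is \<otimes>. *)
definition Omega :: "nat \<Rightarrow> (nat \<Rightarrow> int) monoid" where
  "Omega N = sum_group {1..} (\<lambda>_. integer_mod_group N)"

lemma carrier_Omega:
  assumes "N \<ge> 1"
  shows "carrier (Omega N) = {x \<in> {1..} \<rightarrow>\<^sub>E {0..<int N}. finite {i. 1 \<le> i \<and> x i \<noteq> 0}}"
  using assms by (auto simp: Omega_def carrier_sum_group carrier_integer_mod_group)

lemma comm_group_Omega: "comm_group (Omega N)"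
proof -
  have "group (Omega N)"
    by (simp add: Omega_def)
  then show ?thesis
    by (rule group.group_comm_groupI) (auto simp: Omega_def add.commute)
qed

definition size_Omega :: "nat \<Rightarrow> (nat \<Rightarrow> int) \<Rightarrow> nat" where
  "size_Omega N x = (if x = \<one>\<^bsub>Omega N\<^esub> then 0 else Max {i. 1 \<le> i \<and> x i \<noteq> 0})"

definition positive_distribution :: "(nat \<Rightarrow> real) \<Rightarrow> bool" where
  "positive_distribution r \<longleftrightarrow> (\<forall>j\<ge>1. 0 < r j) \<and> (r has_sum 1) {1..}"

definition step_mass :: "nat \<Rightarrow> (nat \<Rightarrow> real) \<Rightarrow> (nat \<Rightarrow> int) \<Rightarrow> real" where
  "step_mass N r y =
    (if y = \<one>\<^bsub>Omega N\<^esub> then 0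
     else r (size_Omega N y) / (real N ^ (size_Omega N y - 1) * (real N - 1)))"

definition rj_random_walk ::
  "nat \<Rightarrow> (nat \<Rightarrow> real) \<Rightarrow> 'w measure \<Rightarrow> (nat \<Rightarrow> 'w \<Rightarrow> nat \<Rightarrow> int) \<Rightarrow> bool" where
  "rj_random_walk N r M \<xi> \<longleftrightarrow>
    prob_space M \<and> positive_distribution r \<and>
    (\<exists>\<eta>. prob_space.indep_vars M (\<lambda>_. count_space (carrier (Omega N))) \<eta> {1..} \<and>
         (\<forall>i\<ge>1. \<forall>y\<in>carrier (Omega N). \<P>(\<omega> in M. \<eta> i \<omega> = y) = step_mass N r y) \<and>
         (\<forall>n. \<forall>\<omega>\<in>space M. \<xi> n \<omega> = finprod (Omega N) (\<lambda>i. \<eta> i \<omega>) {1..n}))"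

definition geometric_rates :: "nat \<Rightarrow> real \<Rightarrow> nat \<Rightarrow> real" where
  "geometric_rates N c j = (1 - c / real N) * (c / real N) ^ (j - 1)"

definition cj_random_walk ::
  "nat \<Rightarrow> real \<Rightarrow> 'w measure \<Rightarrow> (nat \<Rightarrow> 'w \<Rightarrow> nat \<Rightarrow> int) \<Rightarrow> bool" where
  "cj_random_walk N c M \<xi> \<longleftrightarrow> rj_random_walk N (geometric_rates N c) M \<xi>"

definition Z_size :: "nat \<Rightarrow> (nat \<Rightarrow> 'w \<Rightarrow> nat \<Rightarrow> int) \<Rightarrow> nat \<Rightarrow> 'w \<Rightarrow> nat" where
  "Z_size N \<xi> n \<omega> = size_Omega N (\<xi> n \<omega>)"

definition Z_star :: "nat \<Rightarrow> (nat \<Rightarrow> 'w \<Rightarrow> nat \<Rightarrow> int) \<Rightarrow> nat \<Rightarrow> 'w \<Rightarrow> nat" where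
  "Z_star N \<xi> n \<omega> = Max ((\<lambda>m. Z_size N \<xi> m \<omega>) ` {1..n})"

end

theory Submission
  imports Defs
begin

text \<open>The elements of size at most \<open>k\<close> form a subgroup of order \<open>N ^ k\<close>. Hence the first \<open>n\<close>
  partial sums all lie in it if and only if the first \<open>n\<close> steps do, and by independence this has
  probability \<open>(r 1 + \<dots> + r k) ^ n\<close>. Both formulas follow by taking differences.\<close>

text \<open>The ball of radius \<open>k\<close> about the identity, described by coordinates rather
  than by \<open>size_Omega\<close>, so that closure and counting can be checked coordinatewise.
  Only indices \<open>i > k\<close> are constrained, so the meaningless value at 0 never enters,
  even for \<open>k = 0\<close>.\<close>

definition ball_Omega :: "nat \<Rightarrow> nat \<Rightarrow> (nat \<Rightarrow> int) set" where
  "ball_Omega N k = {x \<in> carrier (Omega N). \<forall>i>k. x i = 0}"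

lemma one_Omega: "\<one>\<^bsub>Omega N\<^esub> = (\<lambda>i\<in>{1..}. 0)"
  by (simp add: Omega_def)

lemma ball_Omega_mono: "k \<le> l \<Longrightarrow> ball_Omega N k \<subseteq> ball_Omega N l"
  by (auto simp: ball_Omega_def)

lemma size_Omega_le_iff:
  assumes "N \<ge> 1" and "x \<in> carrier (Omega N)"
  shows "size_Omega N x \<le> k \<longleftrightarrow> x \<in> ball_Omega N k"
proof (cases "x = \<one>\<^bsub>Omega N\<^esub>")
  case True
  then show ?thesis using assms by (auto simp: size_Omega_def ball_Omega_def one_Omega)
next
  case False
  have x: "x \<in> extensional {1..}" and fin: "finite {i. 1 \<le> i \<and> x i \<noteq> 0}"
    using assms by (auto simp: carrier_Omega PiE_def)
  \<comment> \<open>\<open>Max\<close> is determined by its elements only on a finite nonempty set.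
    An element with empty support agrees with the identity on the positive indices, and
    extensionality makes the two equal.\<close>
  have "{i. 1 \<le> i \<and> x i \<noteq> 0} \<noteq> {}"
  proof
    assume "{i. 1 \<le> i \<and> x i \<noteq> 0} = {}"
    then have "x = \<one>\<^bsub>Omega N\<^esub>"
      using x by (intro extensionalityI[of _ "{1..}"]) (auto simp: one_Omega)
    with False show False by simp
  qed
  then have "size_Omega N x \<le> k \<longleftrightarrow> (\<forall>i. 1 \<le> i \<and> x i \<noteq> 0 \<longrightarrow> i \<le> k)"
    using False fin by (simp add: size_Omega_def)
  also have "\<dots> \<longleftrightarrow> (\<forall>i>k. x i = 0)"
    by (rule all_cong1) auto
  also have "\<dots> \<longleftrightarrow> x \<in> ball_Omega N k"
    using assms(2) by (simp add: ball_Omega_def)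
  finally show ?thesis .
qed

lemma subgroup_ball_Omega:
  assumes "N \<ge> 1"
  shows "subgroup (ball_Omega N k) (Omega N)"
proof -
  interpret comm_group "Omega N" by (rule comm_group_Omega)
  show ?thesis
  proof (rule subgroupI)
    show "ball_Omega N k \<subseteq> carrier (Omega N)" by (auto simp: ball_Omega_def)
    have "\<one>\<^bsub>Omega N\<^esub> \<in> ball_Omega N k"
      using one_closed by (auto simp: ball_Omega_def one_Omega)
    then show "ball_Omega N k \<noteq> {}" by blast
  next
    fix x assume x: "x \<in> ball_Omega N k"
    then have "inv\<^bsub>Omega N\<^esub> x = (\<lambda>i\<in>{1..}. inv\<^bsub>integer_mod_group N\<^esub> x i)"
      unfolding Omega_def ball_Omega_def by (subst inv_sum_group) auto
    \<comment> \<open>Inverses are taken coordinatewise, so a coordinate beyond \<open>k\<close>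
      stays 0 because 0 is the identity of the cyclic group.\<close>
    moreover have "inv\<^bsub>integer_mod_group N\<^esub> 0 = (0::int)"
      using monoid.inv_one[OF group.is_monoid[OF group_integer_mod_group], of N] by simp
    ultimately show "inv\<^bsub>Omega N\<^esub> x \<in> ball_Omega N k"
      using x inv_closed[of x] by (auto simp: ball_Omega_def)
  next
    fix x y assume "x \<in> ball_Omega N k" "y \<in> ball_Omega N k"
    then show "x \<otimes>\<^bsub>Omega N\<^esub> y \<in> ball_Omega N k"
      using m_closed[of x y] by (auto simp: ball_Omega_def) (auto simp: Omega_def)
  qed
qed

text \<open>The first \<open>k\<close> coordinates are arbitrary residues and determine the element.
  The inverse map pads with zeros, leaving index 0 undefined so that the result is extensional. This
  gives finiteness and the order of the ball.\<close>

lemma ball_Omega_bij: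
  assumes "N \<ge> 1"
  shows "bij_betw (\<lambda>x. restrict x {1..k}) (ball_Omega N k) ({1..k} \<rightarrow>\<^sub>E {0..<int N})"
proof (rule bij_betw_byWitness[where f' = "\<lambda>x. \<lambda>i\<in>{1..}. if i \<le> k then x i else 0"])
  show "\<forall>x\<in>ball_Omega N k. (\<lambda>i\<in>{1..}. if i \<le> k then restrict x {1..k} i else 0) = x"
    using assms by (auto simp: ball_Omega_def carrier_Omega fun_eq_iff PiE_def extensional_def)
  show "\<forall>x\<in>{1..k} \<rightarrow>\<^sub>E {0..<int N}. restrict (\<lambda>i\<in>{1..}. if i \<le> k then x i else 0) {1..k} = x"
    by (auto simp: fun_eq_iff PiE_def extensional_def)
  show "(\<lambda>x. restrict x {1..k}) ` ball_Omega N k \<subseteq> {1..k} \<rightarrow>\<^sub>E {0..<int N}"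
    using assms by (auto simp: ball_Omega_def carrier_Omega PiE_def Pi_def)
  have "finite {i. 1 \<le> i \<and> (\<lambda>i\<in>{1..}. if i \<le> k then x i else 0) i \<noteq> (0::int)}" for x
    by (rule finite_subset[of _ "{..k}"]) (auto split: if_splits)
  then show "(\<lambda>x. \<lambda>i\<in>{1..}. if i \<le> k then x i else 0) ` ({1..k} \<rightarrow>\<^sub>E {0..<int N})
      \<subseteq> ball_Omega N k"
    using assms unfolding ball_Omega_def carrier_Omega[OF assms]
    by (auto simp: PiE_def Pi_def)
qed

lemma finite_ball_Omega: "N \<ge> 1 \<Longrightarrow> finite (ball_Omega N k)"
  using bij_betw_finite[OF ball_Omega_bij[of N k]] by (simp add: finite_PiE)

lemma card_ball_Omega: "N \<ge> 1 \<Longrightarrow> card (ball_Omega N k) = N ^ k"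
  using bij_betw_same_card[OF ball_Omega_bij[of N k]] by (simp add: card_PiE)

text \<open>The elements of size exactly \<open>k + 1\<close> number
  \<open>N^(k+1) - N^k = N^k * (N - 1)\<close>, which is the denominator in
  \<open>step_mass\<close>. Each sphere therefore carries total mass \<open>r (Suc k)\<close>, and
  the spheres are added up by induction.\<close>

lemma sum_step_mass_ball_Omega:
  assumes "N \<ge> 2"
  shows "(\<Sum>y\<in>ball_Omega N k. step_mass N r y) = (\<Sum>i=1..k. r i)"
proof (induction k)
  case 0
  have N: "N \<ge> 1" using assms by simp
  have "\<one>\<^bsub>Omega N\<^esub> \<in> ball_Omega N 0"
    using subgroup.one_closed[OF subgroup_ball_Omega[OF N]] .
  \<comment> \<open>Having one element, the ball of radius 0 contains only the identity, to which a
    step gives mass 0.\<close>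
  moreover have "card (ball_Omega N 0) = 1" using card_ball_Omega[OF N] by simp
  ultimately have "ball_Omega N 0 = {\<one>\<^bsub>Omega N\<^esub>}"
    by (metis card_1_singletonE singletonD)
  then show ?case by (simp add: step_mass_def)
next
  case (Suc k)
  have N: "N \<ge> 1" using assms by simp
  let ?S = "ball_Omega N (Suc k) - ball_Omega N k"
  have sub: "ball_Omega N k \<subseteq> ball_Omega N (Suc k)" by (rule ball_Omega_mono) simp
  have "step_mass N r y = r (Suc k) / (real N ^ k * (real N - 1))" if "y \<in> ?S" for y
  proof -
    have "y \<in> carrier (Omega N)" using that by (simp add: ball_Omega_def)
    then have size: "size_Omega N y = Suc k"
      using that size_Omega_le_iff[OF N, of y k] size_Omega_le_iff[OF N, of y "Suc k"] by simp
    then have "y \<noteq> \<one>\<^bsub>Omega N\<^esub>" by (auto simp: size_Omega_def)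
    with size show ?thesis by (simp add: step_mass_def)
  qed
  then have "(\<Sum>y\<in>?S. step_mass N r y) = card ?S * (r (Suc k) / (real N ^ k * (real N - 1)))"
    by simp
  also have "card ?S = N ^ Suc k - N ^ k"
    by (simp only: card_Diff_subset[OF finite_ball_Omega[OF N] sub] card_ball_Omega[OF N])
  also have "real (N ^ Suc k - N ^ k) = real N ^ k * (real N - 1)"
    using N by (subst of_nat_diff) (auto simp: algebra_simps)
  \<comment> \<open>The cancellation needs \<open>N - 1\<close> to be nonzero, which is where
    \<open>N \<ge> 2\<close> enters.\<close>
  also have "\<dots> * (r (Suc k) / (real N ^ k * (real N - 1))) = r (Suc k)"
    using assms by simp
  finally show ?case
    using Suc sum.subset_diff[OF sub finite_ball_Omega[OF N], of "step_mass N r"] by simp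
qed

text \<open>Each factor is the quotient of two consecutive partial products, so it lies in
  \<open>H\<close> when both of them do. The converse is closure under products.\<close>

lemma (in comm_group) partial_products_in_subgroup_iff:
  assumes H: "subgroup H G" and f: "\<And>i. 1 \<le> i \<Longrightarrow> f i \<in> carrier G"
  shows "(\<forall>m\<in>{1..n::nat}. finprod G f {1..m} \<in> H) \<longleftrightarrow> (\<forall>i\<in>{1..n}. f i \<in> H)"
proof
  assume L: "\<forall>m\<in>{1..n}. finprod G f {1..m} \<in> H"
  show "\<forall>i\<in>{1..n}. f i \<in> H"
  proof
    fix i assume i: "i \<in> {1..n}"
    then obtain m where m: "i = Suc m" by (cases i) auto
    let ?p = "finprod G f {1..m}"
    \<comment> \<open>For \<open>m = 0\<close> the assumption says nothing, but the empty product is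
      the identity.\<close>
    have p: "?p \<in> H"
      using L i m subgroup.one_closed[OF H] by (cases "m = 0") auto
    have "finprod G f {1..Suc m} = f (Suc m) \<otimes> ?p"
      using f by (simp add: atLeastAtMostSuc_conv Pi_def)
    moreover have "finprod G f {1..Suc m} \<in> H"
      using L i m by blast
    ultimately have "f (Suc m) \<otimes> ?p \<in> H" by simp
    with p have "(f (Suc m) \<otimes> ?p) \<otimes> inv ?p \<in> H"
      using H by (simp add: subgroup.m_closed subgroup.m_inv_closed)
    moreover have "?p \<in> carrier G" using p H by (rule subgroup.mem_carrier[rotated])
    ultimately show "f i \<in> H" using m f[of "Suc m"] by (simp add: m_assoc)
  qed
next
  assume R: "\<forall>i\<in>{1..n}. f i \<in> H"
  show "\<forall>m\<in>{1..n}. finprod G f {1..m} \<in> H"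
  proof
    fix m assume "m \<in> {1..n}"
    then have "m \<le> n" by simp
    then show "finprod G f {1..m} \<in> H"
    proof (induction m)
      case 0
      then show ?case using subgroup.one_closed[OF H] by simp
    next
      case (Suc m)
      then show ?case
        using R f subgroup.m_closed[OF H, of "f (Suc m)" "finprod G f {1..m}"]
        by (simp add: atLeastAtMostSuc_conv Pi_def)
    qed
  qed
qed

text \<open>Bounding the maximum confines the dependent variables \<open>\<xi> m\<close>; the
  subgroup property turns this into a condition on the independent steps. Measurability is stated as
  well, since differences and complements of these events are taken later.\<close>

lemma Z_star_le_prob:
  assumes N: "N \<ge> 2" and walk: "rj_random_walk N r M \<xi>" and n: "n \<ge> 1"
  shows "{\<omega> \<in> space M. Z_star N \<xi> n \<omega> \<le> k} \<in> sets M" (is "?E \<in> _")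
    and "\<P>(\<omega> in M. Z_star N \<xi> n \<omega> \<le> k) = (\<Sum>i=1..k. r i) ^ n"
proof -
  interpret prob_space M using walk by (simp add: rj_random_walk_def)
  interpret G: comm_group "Omega N" by (rule comm_group_Omega)
  have N1: "N \<ge> 1" using N by simp
  let ?B = "ball_Omega N k"
  obtain \<eta> where indep: "indep_vars (\<lambda>_. count_space (carrier (Omega N))) \<eta> {1..}"
    and law: "\<And>i y. i \<ge> 1 \<Longrightarrow> y \<in> carrier (Omega N) \<Longrightarrow> \<P>(\<omega> in M. \<eta> i \<omega> = y) = step_mass N r y"
    and \<xi>: "\<And>n \<omega>. \<omega> \<in> space M \<Longrightarrow> \<xi> n \<omega> = finprod (Omega N) (\<lambda>i. \<eta> i \<omega>) {1..n}"
    using walk by (auto simp: rj_random_walk_def)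
  have meas: "\<eta> i \<in> measurable M (count_space (carrier (Omega N)))" if "i \<ge> 1" for i
    using indep that by (simp add: indep_vars_def)
  have \<eta>: "\<eta> i \<omega> \<in> carrier (Omega N)" if "\<omega> \<in> space M" "i \<ge> 1" for i \<omega>
    using measurable_space[OF meas[OF that(2)] that(1)] by simp
  have B: "?B \<subseteq> carrier (Omega N)" by (auto simp: ball_Omega_def)
  have ev: "\<eta> i -` A \<inter> space M \<in> events" if "i \<ge> 1" "A \<subseteq> carrier (Omega N)" for i A
    using measurable_sets[OF meas[OF that(1)], of A] that(2) by simp
  have step: "prob (\<eta> i -` ?B \<inter> space M) = (\<Sum>j=1..k. r j)" if i: "i \<ge> 1" for i
  proof -
    \<comment> \<open>The ball is finite, so its probability is a finite sum of the point masses
      given by \<open>law\<close>.\<close>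
    have "\<eta> i -` ?B \<inter> space M = (\<Union>y\<in>?B. \<eta> i -` {y} \<inter> space M)" by auto
    moreover have "prob (\<Union>y\<in>?B. \<eta> i -` {y} \<inter> space M)
        = (\<Sum>y\<in>?B. prob (\<eta> i -` {y} \<inter> space M))"
      using finite_ball_Omega[OF N1] B ev[OF i]
      by (intro finite_measure_finite_Union) (auto simp: disjoint_family_on_def)
    ultimately have "prob (\<eta> i -` ?B \<inter> space M) = (\<Sum>y\<in>?B. prob (\<eta> i -` {y} \<inter> space M))"
      by simp
    also have "\<dots> = (\<Sum>y\<in>?B. step_mass N r y)"
    proof (rule sum.cong)
      fix y assume "y \<in> ?B"
      moreover have "\<eta> i -` {y} \<inter> space M = {\<omega> \<in> space M. \<eta> i \<omega> = y}" by auto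
      ultimately show "prob (\<eta> i -` {y} \<inter> space M) = step_mass N r y" using law i B by auto
    qed simp
    finally show ?thesis by (simp add: sum_step_mass_ball_Omega[OF N])
  qed
  have E: "?E = (\<Inter>i\<in>{1..n}. \<eta> i -` ?B \<inter> space M)"
  proof -
    have "Z_star N \<xi> n \<omega> \<le> k \<longleftrightarrow> (\<forall>i\<in>{1..n}. \<eta> i \<omega> \<in> ?B)" if \<omega>: "\<omega> \<in> space M" for \<omega>
    proof -
      have "\<xi> m \<omega> \<in> carrier (Omega N)" for m
        using \<xi>[OF \<omega>] \<eta>[OF \<omega>] by (auto intro!: G.finprod_closed)
      \<comment> \<open>Since \<open>n \<ge> 1\<close>, the maximum runs over a nonempty set and is
        at most \<open>k\<close> exactly when every term is.\<close>
      then have "Z_star N \<xi> n \<omega> \<le> k \<longleftrightarrow> (\<forall>m\<in>{1..n}. \<xi> m \<omega> \<in> ?B)"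
        using n by (simp add: Z_star_def Z_size_def size_Omega_le_iff[OF N1])
      then show ?thesis
        using G.partial_products_in_subgroup_iff[OF subgroup_ball_Omega[OF N1],
            of "\<lambda>i. \<eta> i \<omega>" n k] \<eta>[OF \<omega>] \<xi>[OF \<omega>] by simp
    qed
    then show ?thesis using n by auto
  qed
  show "?E \<in> sets M"
    unfolding E using n ev B by (intro sets.finite_INT) auto
  \<comment> \<open>Independence gives the product formula for finite nonempty index sets, hence
    again \<open>n \<ge> 1\<close>.\<close>
  have "prob ?E = (\<Prod>i\<in>{1..n}. prob (\<eta> i -` ?B \<inter> space M))"
    unfolding E using n B by (intro indep_varsD[OF indep]) auto
  also have "\<dots> = (\<Sum>i=1..k. r i) ^ n"
    using step by simp
  finally show "\<P>(\<omega> in M. Z_star N \<xi> n \<omega> \<le> k) = (\<Sum>i=1..k. r i) ^ n" .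
qed

lemma Z_star_prob:
  assumes N: "N \<ge> 2" and walk: "rj_random_walk N r M \<xi>" and j: "j \<ge> 1" and n: "n \<ge> 1"
  shows "\<P>(\<omega> in M. Z_star N \<xi> n \<omega> = j) = (\<Sum>i=1..j. r i) ^ n - (\<Sum>i=1..j-1. r i) ^ n"
    and "\<P>(\<omega> in M. Z_star N \<xi> n \<omega> \<ge> j) = 1 - (\<Sum>i=1..j-1. r i) ^ n"
proof -
  interpret prob_space M using walk by (simp add: rj_random_walk_def)
  let ?E = "\<lambda>k. {\<omega> \<in> space M. Z_star N \<xi> n \<omega> \<le> k}"
  note E = Z_star_le_prob[OF N walk n]
  \<comment> \<open>For \<open>j \<ge> 1\<close> the truncated subtraction is harmless: exceeding
    \<open>j - 1\<close> means being at least \<open>j\<close>.\<close>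
  have "{\<omega> \<in> space M. Z_star N \<xi> n \<omega> = j} = ?E j - ?E (j - 1)"
    using j by auto
  moreover have "?E (j - 1) \<subseteq> ?E j" by auto
  ultimately show "\<P>(\<omega> in M. Z_star N \<xi> n \<omega> = j) = (\<Sum>i=1..j. r i) ^ n - (\<Sum>i=1..j-1. r i) ^ n"
    using finite_measure_Diff[OF E(1) E(1), of "j - 1" j] E(2) by simp
  have "{\<omega> \<in> space M. Z_star N \<xi> n \<omega> \<ge> j} = space M - ?E (j - 1)"
    using j by auto
  then show "\<P>(\<omega> in M. Z_star N \<xi> n \<omega> \<ge> j) = 1 - (\<Sum>i=1..j-1. r i) ^ n"
    using prob_compl[OF E(1), of "j - 1"] E(2) by simp
qed

text \<open>With \<open>q = c / N\<close> the terms are \<open>q^(i-1) - q^i\<close>, so the sum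
  telescopes.\<close>

lemma sum_geometric_rates: "(\<Sum>i=1..k. geometric_rates N c i) = 1 - (c / real N) ^ k"
  by (induction k) (simp_all add: geometric_rates_def algebra_simps)

theorem proposition3p5p8:
  fixes N :: nat and M :: "'w measure" and \<xi> :: "nat \<Rightarrow> 'w \<Rightarrow> nat \<Rightarrow> int"
  assumes "N \<ge> 2"
  shows "(\<forall>r. rj_random_walk N r M \<xi> \<longrightarrow>
            (\<forall>j\<ge>1. \<forall>n\<ge>1.
              \<P>(\<omega> in M. Z_star N \<xi> n \<omega> = j) = (\<Sum>i=1..j. r i) ^ n - (\<Sum>i=1..j-1. r i) ^ n \<and>
              \<P>(\<omega> in M. Z_star N \<xi> n \<omega> \<ge> j) = 1 - (\<Sum>i=1..j-1. r i) ^ n)) \<and>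
         (\<forall>c. 0 < c \<and> c < real N \<and> cj_random_walk N c M \<xi> \<longrightarrow>
            (\<forall>j\<ge>1. \<forall>n\<ge>1.
              \<P>(\<omega> in M. Z_star N \<xi> n \<omega> = j)
                = (1 - (c / real N) ^ j) ^ n - (1 - (c / real N) ^ (j - 1)) ^ n \<and>
              \<P>(\<omega> in M. Z_star N \<xi> n \<omega> \<ge> j) = 1 - (1 - (c / real N) ^ (j - 1)) ^ n))"
  unfolding cj_random_walk_def
  \<comment> \<open>The second part is the first for the geometric rates, with the partial sums
    evaluated.\<close>
  by (intro conjI allI impI; (elim conjE)?)
    (simp_all only: Z_star_prob[OF assms] sum_geometric_rates)

end
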